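(* Let $\alpha\in\mathbb{R}^{d}_{++}$ with $\sum_{i\in[d]}\alpha_i=1$, let $f^*(u,w)=-\ln\big(\prod_{i\in[d]}(u_i/\alpha_i)^{\alpha_i}+w\big)-\sum_{i\in[d]}(1-\alpha_i)\ln(u_i/\alpha_i)-\ln(-w)$ be the barrier function of the dual cone $\mathcal{K}^*_{\mathrm{powm}(\alpha,d)}$ of the power mean cone, and let $z=(u,w)$ be in the interior of $\mathcal{K}^*_{\mathrm{powm}(\alpha,d)}$. Then the Hessian $H^*(z)=\nabla^2f^*(z)$ is augmented-sparse with $n_1=1$, $n_2=2$; namely $$H^*(z)=D+pp^\top-qq^\top-rr^\top,\qquad D-qq^\top-rr^\top\succ0,$$ where, with $\varphi=\prod_{i\in[d]}(u_i/\alpha_i)^{\alpha_i}$, $\zeta=\varphi+w$, and $\tau\in\mathbb{R}^d$, $\tau_i=\frac{\alpha_i}{u_i\zeta}$ for all $i\in[d]$, $D$ is the diagonal matrix whose first $d$ diagonal entries are $\frac{\tau_i\varphi}{u_i}+\frac{1-\alpha_i}{u_i^2}$ $(i\in[d])$ and whose last diagonal entry is $\theta$, and $$p=\begin{bmatrix}p_0\,\tau\\ p_1/\zeta\end{bmatrix},\quad q=\begin{bmatrix}q_0\,\tau\\0\end{bmatrix},\quad r=\begin{bmatrix}0\\ r_1/\zeta\end{bmatrix},$$ $$\theta=1+\frac1{w^2},\quad p_0=\varphi,\quad p_1=1,\quad q_0=\sqrt{\zeta\varphi},\quad r_1=\zeta.$$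
   Context: $[d]=\{1,\dots,d\}$; $\mathbb{R}^d_+$ and $\mathbb{R}^d_{++}$ are the vectors with nonnegative, resp. positive, entries; $\mathbb{R}_-$ is the set of nonpositive reals. The power mean cone is $\mathcal{K}_{\mathrm{powm}(\alpha,d)}=\{(u,w)\in\mathbb{R}^{d}_+\times\mathbb{R}:\prod_{i\in[d]}u_i^{\alpha_i}\ge w\}$, and its dual cone is $\mathcal{K}^*_{\mathrm{powm}(\alpha,d)}=\{(u,w)\in\mathbb{R}^{d}_+\times\mathbb{R}_-:\prod_{i\in[d]}(u_i/\alpha_i)^{\alpha_i}\ge-w\}$. A matrix of the form $H=D+\sum_{i=1}^{n_1}u_iu_i^\top-\sum_{j=1}^{n_2}v_jv_j^\top$, with $D$ an $n\times n$ symmetric sparse matrix and $n_1,n_2\ll n$, is called augmented-sparse if $D-\sum_{j=1}^{n_2}v_jv_j^\top\succ0$ (positive definite).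
   Formalization: Positive definiteness of D−qq^T−rr^T (hence augmented-sparsity) is claimed only for d≥2: for d=1 (α=1) this matrix is diag(0,1/w²), which is singular, so the claim fails; the Hessian formula is proved for all d≥1. *)

theory Defs
  imports "HOL-Analysis.Analysis"
begin

section \<open>Block vectors and matrices\<close>

text \<open>
  Points \<open>(u, w)\<close> of \<open>\<real>\<^sup>d \<times> \<real>\<close> are vectors over the index type \<open>'d + unit\<close>, so that
  the Hessian is an ordinary square matrix of size \<open>d + 1\<close>.
\<close>

definition block_vec :: "real ^ 'd \<Rightarrow> real \<Rightarrow> real ^ ('d + unit)" where
  "block_vec u w = (\<chi> k. case k of Inl i \<Rightarrow> u $ i | Inr _ \<Rightarrow> w)"

definition diag_mat :: "real ^ 'n \<Rightarrow> real ^ 'n ^ 'n" where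
  "diag_mat v = (\<chi> i j. if i = j then v $ i else 0)"

definition outer :: "real ^ 'n \<Rightarrow> real ^ 'n \<Rightarrow> real ^ 'n ^ 'n" where
  "outer x y = (\<chi> i j. x $ i * y $ j)"

definition pos_def :: "real ^ 'n ^ 'n \<Rightarrow> bool" where
  "pos_def A \<longleftrightarrow> transpose A = A \<and> (\<forall>x. x \<noteq> 0 \<longrightarrow> 0 < x \<bullet> (A *v x))"

text \<open>
  Augmented-sparse form with \<open>n\<^sub>1 = length us\<close> and \<open>n\<^sub>2 = length vs\<close>. The informal requirements
  that \<open>D\<close> is sparse and that \<open>n\<^sub>1\<close>, \<open>n\<^sub>2\<close> are much smaller than the dimension have no precise
  meaning for a single matrix; the witnesses \<open>D\<close>, \<open>us\<close>, \<open>vs\<close> are therefore arguments of the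
  predicate instead of being existentially quantified.
\<close>

definition augmented_sparse ::
  "real ^ 'n ^ 'n \<Rightarrow> real ^ 'n ^ 'n \<Rightarrow> (real ^ 'n) list \<Rightarrow> (real ^ 'n) list \<Rightarrow> bool" where
  "augmented_sparse H D us vs \<longleftrightarrow>
     transpose D = D \<and>
     H = D + (\<Sum>x\<leftarrow>us. outer x x) - (\<Sum>x\<leftarrow>vs. outer x x) \<and>
     pos_def (D - (\<Sum>x\<leftarrow>vs. outer x x))"


section \<open>Hessians\<close>

definition has_hessian :: "(real ^ 'n \<Rightarrow> real) \<Rightarrow> real ^ 'n ^ 'n \<Rightarrow> real ^ 'n \<Rightarrow> bool" where
  "has_hessian f H x \<longleftrightarrow>
     (\<exists>g. (\<forall>\<^sub>F y in nhds x. GDERIV f y :> g y) \<and> (g has_derivative (\<lambda>h. H *v h)) (at x))"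

lemma has_hessian_unique:
  assumes "has_hessian f H x" "has_hessian f H' x"
  shows "H = H'"
proof -
  obtain g where g: "\<forall>\<^sub>F y in nhds x. GDERIV f y :> g y" "(g has_derivative (\<lambda>h. H *v h)) (at x)"
    using assms(1) by (auto simp: has_hessian_def)
  obtain g' where g': "\<forall>\<^sub>F y in nhds x. GDERIV f y :> g' y" "(g' has_derivative (\<lambda>h. H' *v h)) (at x)"
    using assms(2) by (auto simp: has_hessian_def)
  have eq: "\<forall>\<^sub>F y in nhds x. g y = g' y"
    using g(1) g'(1)
  proof eventually_elim
    case (elim y)
    then have "(\<lambda>h. h \<bullet> g y) = (\<lambda>h. h \<bullet> g' y)"
      unfolding gderiv_def by (rule has_derivative_unique)
    then show "g y = g' y"
      by (metis vector_eq_ldot)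
  qed
  have "g x = g' x"
    using eq by (rule eventually_nhds_x_imp_x)
  moreover have "\<forall>\<^sub>F y in at x. g y = g' y"
    using eq by (simp add: eventually_nhds_conv_at)
  ultimately have "(g' has_derivative (\<lambda>h. H *v h)) (at x)"
    using has_derivative_transform_eventually[OF g(2), of g'] by simp
  then have "(\<lambda>h. H *v h) = (\<lambda>h. H' *v h)"
    using g'(2) by (rule has_derivative_unique)
  then show ?thesis
    by (metis matrix_eq)
qed


section \<open>The power mean cone, its dual, and the dual barrier\<close>

definition dual_cone :: "'a::real_inner set \<Rightarrow> 'a set" where
  "dual_cone K = {y. \<forall>x\<in>K. 0 \<le> y \<bullet> x}"

definition powm_cone :: "real ^ 'd \<Rightarrow> (real ^ ('d + unit)) set" where
  "powm_cone \<alpha> =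
     {block_vec u w | u w. (\<forall>i. 0 \<le> u $ i) \<and> w \<le> (\<Prod>i\<in>UNIV. (u $ i) powr (\<alpha> $ i))}"

definition powm_dual_cone :: "real ^ 'd \<Rightarrow> (real ^ ('d + unit)) set" where
  "powm_dual_cone \<alpha> =
     {block_vec u w | u w. (\<forall>i. 0 \<le> u $ i) \<and> w \<le> 0 \<and>
        - w \<le> (\<Prod>i\<in>UNIV. (u $ i / \<alpha> $ i) powr (\<alpha> $ i))}"

text \<open>
  If \<open>d = 1\<close> (so \<open>\<alpha> = 1\<close>) the barrier is \<open>- ln (u + w) - ln (- w)\<close>. Removing its single positive
  rank-one term from the Hessian, in the decomposition of the theorem, leaves the singular matrix
  \<open>diag (0, 1 / w\<^sup>2)\<close>. Definiteness is therefore claimed only for \<open>d \<ge> 2\<close>.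
\<close>

definition powm_dual_barrier :: "real ^ 'd \<Rightarrow> real ^ ('d + unit) \<Rightarrow> real" where
  "powm_dual_barrier \<alpha> z =
     (let u = (\<lambda>i. z $ Inl i); w = z $ Inr () in
        - ln ((\<Prod>i\<in>UNIV. (u i / \<alpha> $ i) powr (\<alpha> $ i)) + w)
        - (\<Sum>i\<in>UNIV. (1 - \<alpha> $ i) * ln (u i / \<alpha> $ i))
        - ln (- w))"

lemma block_vec_nth [simp]: "block_vec u w $ Inl i = u $ i" "block_vec u w $ Inr j = w"
  by (simp_all add: block_vec_def)

lemma block_vec_inner: "block_vec u w \<bullet> block_vec u' w' = u \<bullet> u' + w * w'"
  unfolding inner_vec_def
  by (subst UNIV_Plus_UNIV [symmetric], subst sum.Plus) (simp_all add: UNIV_unit)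

lemma weighted_arith_geom_mean:
  fixes \<alpha> x :: "'i \<Rightarrow> real"
  assumes fin: "finite S" and \<alpha>: "\<And>i. i \<in> S \<Longrightarrow> 0 < \<alpha> i" "sum \<alpha> S = 1"
    and x: "\<And>i. i \<in> S \<Longrightarrow> 0 \<le> x i"
  shows "(\<Prod>i\<in>S. x i powr \<alpha> i) \<le> (\<Sum>i\<in>S. \<alpha> i * x i)"
proof (cases "\<exists>i\<in>S. x i = 0")
  case True
  then have "(\<Prod>i\<in>S. x i powr \<alpha> i) = 0"
    using fin by auto
  moreover have "0 \<le> (\<Sum>i\<in>S. \<alpha> i * x i)"
    using \<alpha>(1) x by (intro sum_nonneg mult_nonneg_nonneg) (auto simp: less_imp_le)
  ultimately show ?thesis
    by simp
next
  case False
  then have pos: "0 < x i" if "i \<in> S" for i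
    using x that by force
  have ne: "S \<noteq> {}"
    using \<alpha>(2) by auto
  have "(\<Sum>i\<in>S. \<alpha> i * ln (x i)) \<le> ln (\<Sum>i\<in>S. \<alpha> i *\<^sub>R x i)"
    using ln_concave fin ne \<alpha> pos
    by (intro concave_on_sum [where C = "{0<..}"]) (auto simp: less_imp_le)
  moreover have "0 < (\<Sum>i\<in>S. \<alpha> i *\<^sub>R x i)"
    using fin ne \<alpha> pos by (intro sum_pos) auto
  ultimately have "exp (\<Sum>i\<in>S. \<alpha> i * ln (x i)) \<le> (\<Sum>i\<in>S. \<alpha> i *\<^sub>R x i)"
    by (simp add: ln_ge_iff)
  moreover have "exp (\<Sum>i\<in>S. \<alpha> i * ln (x i)) = (\<Prod>i\<in>S. x i powr \<alpha> i)"
    unfolding exp_sum [OF fin] using pos by (intro prod.cong) (force simp: powr_def)+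
  ultimately show ?thesis
    by simp
qed

theorem dual_cone_powm_cone:
  fixes \<alpha> :: "real ^ 'd"
  assumes \<alpha>: "\<And>i. 0 < \<alpha> $ i" "(\<Sum>i\<in>UNIV. \<alpha> $ i) = 1"
  shows "dual_cone (powm_cone \<alpha>) = powm_dual_cone \<alpha>"
proof (intro equalityI subsetI)
  fix z assume z: "z \<in> powm_dual_cone \<alpha>"
  then obtain y s where ys: "z = block_vec y s" "\<And>i. 0 \<le> y $ i" "s \<le> 0"
      "- s \<le> (\<Prod>i\<in>UNIV. (y $ i / \<alpha> $ i) powr (\<alpha> $ i))"
    by (auto simp: powm_dual_cone_def)
  show "z \<in> dual_cone (powm_cone \<alpha>)"
    unfolding dual_cone_def
  proof (intro CollectI ballI)
    fix v assume "v \<in> powm_cone \<alpha>"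
    then obtain u w where uw: "v = block_vec u w" "\<And>i. 0 \<le> u $ i"
        "w \<le> (\<Prod>i\<in>UNIV. (u $ i) powr (\<alpha> $ i))"
      by (auto simp: powm_cone_def)
    let ?U = "\<Prod>i\<in>UNIV. (u $ i) powr (\<alpha> $ i)"
    have "- s * w \<le> - s * ?U"
      using uw(3) ys(3) by (intro mult_left_mono) auto
    also have "\<dots> \<le> (\<Prod>i\<in>UNIV. (y $ i / \<alpha> $ i) powr (\<alpha> $ i)) * ?U"
      using ys(4) by (intro mult_right_mono prod_nonneg) auto
    also have "\<dots> = (\<Prod>i\<in>UNIV. (y $ i / \<alpha> $ i * u $ i) powr (\<alpha> $ i))"
      unfolding prod.distrib [symmetric]
      by (intro prod.cong refl powr_mult [symmetric])
    also have "\<dots> \<le> (\<Sum>i\<in>UNIV. \<alpha> $ i * (y $ i / \<alpha> $ i * u $ i))"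
      using \<alpha> ys(2) uw(2) by (intro weighted_arith_geom_mean) (auto simp: less_imp_le)
    also have "\<dots> = y \<bullet> u"
      unfolding inner_vec_def
    proof (rule sum.cong)
      show "\<alpha> $ i * (y $ i / \<alpha> $ i * u $ i) = y $ i \<bullet> u $ i" for i
        using \<alpha>(1)[of i] by simp
    qed simp
    finally show "0 \<le> z \<bullet> v"
      by (simp add: ys(1) uw(1) block_vec_inner)
  qed
next
  fix z assume z: "z \<in> dual_cone (powm_cone \<alpha>)"
  define y s where "y = (\<chi> i. z $ Inl i)" and "s = z $ Inr ()"
  have z_eq: "z = block_vec y s"
    by (auto simp: vec_eq_iff y_def s_def block_vec_def split: sum.split)
  have dual: "0 \<le> y \<bullet> u + s * w"
    if "\<And>i. 0 \<le> u $ i" "w \<le> (\<Prod>i\<in>UNIV. (u $ i) powr (\<alpha> $ i))" for u w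
  proof -
    have "block_vec u w \<in> powm_cone \<alpha>"
      using that unfolding powm_cone_def by blast
    then have "0 \<le> block_vec y s \<bullet> block_vec u w"
      using z unfolding dual_cone_def z_eq by blast
    then show ?thesis
      by (simp add: block_vec_inner)
  qed
  have s: "s \<le> 0"
    using dual[of 0 "-1"] by (simp add: zero_power)
  have y: "0 \<le> y $ i" for i
  proof -
    have "0 \<le> y \<bullet> axis i 1 + s * 0"
      by (rule dual) (auto simp: axis_def intro!: prod_nonneg)
    then show ?thesis
      by (simp add: inner_axis)
  qed
  have lim: "- s \<le> (\<Prod>i\<in>UNIV. ((y $ i + e) / \<alpha> $ i) powr (\<alpha> $ i))" if "0 < e" for e
  proof -
    let ?u = "\<chi> i. \<alpha> $ i / (y $ i + e)"
    let ?P = "\<Prod>i\<in>UNIV. ((y $ i + e) / \<alpha> $ i) powr (\<alpha> $ i)"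
    have ye: "0 < y $ i + e" for i
      using y[of i] that by simp
    have P: "0 < ?P"
      using ye \<alpha>(1) by (intro prod_pos) (metis divide_pos_pos powr_gt_zero order_less_irrefl)
    have U: "(\<Prod>i\<in>UNIV. (?u $ i) powr (\<alpha> $ i)) = inverse ?P"
      unfolding prod_inversef [symmetric] o_def
    proof (rule prod.cong)
      fix i
      have "(?u $ i) powr (\<alpha> $ i) = inverse ((y $ i + e) / \<alpha> $ i) powr (\<alpha> $ i)"
        by simp
      also have "\<dots> = inverse (((y $ i + e) / \<alpha> $ i) powr (\<alpha> $ i))"
        by (rule inverse_powr)
      finally show "(?u $ i) powr (\<alpha> $ i) = inverse (((y $ i + e) / \<alpha> $ i) powr (\<alpha> $ i))" .
    qed simp
    have "y \<bullet> ?u \<le> (\<Sum>i\<in>UNIV. \<alpha> $ i)"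
      unfolding inner_vec_def
    proof (rule sum_mono)
      fix i
      have "y $ i * \<alpha> $ i \<le> \<alpha> $ i * (y $ i + e)"
        using \<alpha>(1)[of i] that by (simp add: algebra_simps)
      then show "y $ i \<bullet> ?u $ i \<le> \<alpha> $ i"
        using ye[of i] by (simp add: divide_simps)
    qed
    moreover have "0 \<le> y \<bullet> ?u + s * inverse ?P"
    proof (rule dual)
      show "0 \<le> ?u $ i" for i
        using \<alpha>(1)[of i] ye[of i] by simp
    qed (simp only: U)
    ultimately have "- s * inverse ?P \<le> 1"
      using \<alpha>(2) by simp
    then show ?thesis
      using P by (simp add: field_simps)
  qed
  have "((\<lambda>e. \<Prod>i\<in>UNIV. ((y $ i + e) / \<alpha> $ i) powr (\<alpha> $ i)) \<longlongrightarrow>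
           (\<Prod>i\<in>UNIV. ((y $ i + 0) / \<alpha> $ i) powr (\<alpha> $ i))) (at_right 0)"
  proof (intro tendsto_prod tendsto_powr2 tendsto_intros)
    show "\<alpha> $ i \<noteq> 0" "0 < \<alpha> $ i" for i
      using \<alpha>(1)[of i] by auto
    show "\<forall>\<^sub>F e in at_right 0. 0 \<le> (y $ i + e) / \<alpha> $ i" for i
      unfolding eventually_at_right_field using y[of i] \<alpha>(1)[of i] by (intro exI[of _ 1]) auto
  qed
  moreover have "\<forall>\<^sub>F e in at_right 0. - s \<le> (\<Prod>i\<in>UNIV. ((y $ i + e) / \<alpha> $ i) powr (\<alpha> $ i))"
    unfolding eventually_at_right_field using lim by (intro exI[of _ 1]) auto
  ultimately have "- s \<le> (\<Prod>i\<in>UNIV. ((y $ i + 0) / \<alpha> $ i) powr (\<alpha> $ i))"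
    by (rule tendsto_lowerbound) simp
  then show "z \<in> powm_dual_cone \<alpha>"
    using y s unfolding z_eq powm_dual_cone_def by auto
qed

end

theory Submission
  imports Defs
begin

text \<open>
  Write \<open>\<phi>\<close> for the weighted geometric mean of the \<open>u\<^sub>i / \<alpha>\<^sub>i\<close> and \<open>\<zeta> = \<phi> + w\<close>. Everything rests on
  the logarithmic derivative \<open>\<partial>\<phi> / \<partial>u\<^sub>i = \<phi> \<alpha>\<^sub>i / u\<^sub>i = \<phi> \<zeta> \<tau>\<^sub>i\<close>. With it the gradient of the barrier is
  explicit (lemma \<open>GDERIV_powm_dual_barrier\<close>), and differentiating once more
  (\<open>has_derivative_barrier_gradient\<close>) shows where each term of the decomposition comes from. The
  summand \<open>- ln \<zeta>\<close> contributes \<open>\<nabla>\<zeta> \<nabla>\<zeta>\<^sup>T / \<zeta>\<^sup>2\<close>, which is exactly \<open>p p\<^sup>T\<close>, and \<open>- \<nabla>\<^sup>2\<phi> / \<zeta>\<close>, which is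
  \<open>- q q\<^sup>T\<close> plus the diagonal \<open>\<tau>\<^sub>i \<phi> / u\<^sub>i\<close>; the remaining logarithms are separable, so their
  contribution is diagonal. The vector \<open>r\<close> is the last unit vector: it cancels the summand \<open>1\<close> that
  \<open>\<theta>\<close> has in excess of \<open>1 / w\<^sup>2\<close>.

  For definiteness, substitute \<open>y\<^sub>i = h\<^sub>i / u\<^sub>i\<close>. The quadratic form of \<open>D - q q\<^sup>T - r r\<^sup>T\<close> becomes
  \<open>\<phi> / \<zeta>\<close> times the variance of \<open>y\<close> under the probability weights \<open>\<alpha>\<close>, plus
  \<open>\<Sum>\<^sub>i (1 - \<alpha>\<^sub>i) y\<^sub>i\<^sup>2 + h\<^sub>w\<^sup>2 / w\<^sup>2\<close>, where \<open>h\<^sub>w\<close> is the last entry of \<open>h\<close>. The variance is nonnegative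
  (\<open>weighted_square_mean\<close>), and the rest is positive for \<open>h \<noteq> 0\<close> as soon as all \<open>\<alpha>\<^sub>i < 1\<close>, that is,
  as soon as there are two weights (\<open>quadratic_form_pos\<close>).

  These computations take place where \<open>u > 0 > w\<close> and \<open>\<zeta> > 0\<close>. This set is open and contains the
  interior of the dual cone, so the gradient formula holds in a neighbourhood of the given point, as
  the definition of the Hessian requires.
\<close>

section \<open>Structured matrices and block vectors\<close>

lemma outer_mult_vec: "outer x y *v h = (y \<bullet> h) *\<^sub>R x"
  by (simp add: vec_eq_iff outer_def matrix_vector_mult_def inner_vec_def sum_distrib_left mult_ac)

lemma diag_mat_mult_vec: "diag_mat v *v h = (\<chi> k. v $ k * h $ k)"
proof -
  have "(\<Sum>j\<in>UNIV. (if k = j then v $ k else 0) * h $ j) = v $ k * h $ k" for k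
    by (simp add: if_distrib[where f = "\<lambda>c. c * _"] sum.delta cong: if_cong)
  then show ?thesis
    by (simp add: vec_eq_iff diag_mat_def matrix_vector_mult_def)
qed

lemma transpose_outer [simp]: "transpose (outer x y) = outer y x"
  by (simp add: vec_eq_iff transpose_def outer_def mult.commute)

lemma transpose_diag_mat [simp]: "transpose (diag_mat v) = diag_mat v"
  by (auto simp: vec_eq_iff transpose_def diag_mat_def)

lemma transpose_diff_real:
  fixes A B :: "real ^ 'n ^ 'm"
  shows "transpose (A - B) = transpose A - transpose B"
  by (simp add: vec_eq_iff transpose_def)

lemma block_vec_exhaust:
  obtains u w where "y = block_vec u w"
proof
  show "y = block_vec (\<chi> i. y $ Inl i) (y $ Inr ())"
    by (auto simp: vec_eq_iff block_vec_def split: sum.split)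
qed

lemma inner_block_vec:
  "h \<bullet> block_vec u w = (\<Sum>i\<in>UNIV. h $ Inl i * u $ i) + h $ Inr () * w"
  by (cases h rule: block_vec_exhaust)
     (simp only: block_vec_inner block_vec_nth, simp add: inner_vec_def)

lemma block_vec_eq_iff: "block_vec u w = block_vec u' w' \<longleftrightarrow> u = u' \<and> w = w'"
  by (metis block_vec_nth vec_eq_iff)

lemma has_derivative_block_vec:
  fixes f :: "'a::real_normed_vector \<Rightarrow> real ^ 'd"
  assumes "\<And>i. ((\<lambda>y. f y $ i) has_derivative (\<lambda>h. f' h $ Inl i)) (at x)"
    and "(g has_derivative (\<lambda>h. f' h $ Inr ())) (at x)"
  shows "((\<lambda>y. block_vec (f y) (g y)) has_derivative f') (at x)"
proof (subst has_derivative_componentwise_within, intro ballI)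
  fix b :: "real ^ ('d + unit)" assume "b \<in> Basis"
  then obtain k where b: "b = axis k 1"
    by (auto simp: Basis_vec_def)
  show "((\<lambda>y. block_vec (f y) (g y) \<bullet> b) has_derivative (\<lambda>h. f' h \<bullet> b)) (at x)"
    using assms by (cases k) (auto simp: b inner_axis)
qed

lemmas has_derivative_vec_nth =
  bounded_linear_imp_has_derivative [OF bounded_linear_vec_nth]


section \<open>The weighted geometric mean\<close>

definition geom_mean :: "real ^ 'd \<Rightarrow> real ^ ('d + unit) \<Rightarrow> real" where
  "geom_mean \<alpha> y = (\<Prod>i\<in>UNIV. (y $ Inl i / \<alpha> $ i) powr (\<alpha> $ i))"

lemma geom_mean_pos:
  assumes "\<And>i. 0 < \<alpha> $ i" "\<And>i. 0 < y $ Inl i"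
  shows "0 < geom_mean \<alpha> y"
  unfolding geom_mean_def
  using assms by (intro prod_pos) (metis divide_pos_pos powr_gt_zero order_less_irrefl)

text \<open>
  On positive vectors the exponential form removes the product and the real powers, so the derivative
  below is that of a linear combination of logarithms. The two forms differ where an entry is zero,
  and therefore the derivative is transferred along the open set of positive vectors.
\<close>

lemma geom_mean_eq_exp:
  assumes "\<And>i. 0 < \<alpha> $ i" "\<And>i. 0 < y $ Inl i"
  shows "geom_mean \<alpha> y = exp (\<Sum>i\<in>UNIV. \<alpha> $ i * ln (y $ Inl i / \<alpha> $ i))"
proof -
  have "(y $ Inl i / \<alpha> $ i) powr (\<alpha> $ i) = exp (\<alpha> $ i * ln (y $ Inl i / \<alpha> $ i))" for i
    using assms[of i] by (simp add: powr_def)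
  then show ?thesis
    by (simp add: geom_mean_def exp_sum)
qed

lemma open_positive_block: "open {y :: real ^ ('d::finite + unit). \<forall>i. 0 < y $ Inl i}"
proof -
  have "{y :: real ^ ('d::finite + unit). \<forall>i. 0 < y $ Inl i} = (\<Inter>i. {y. 0 < y $ Inl i})"
    by auto
  then show ?thesis
    by (auto intro!: open_INT open_Collect_less continuous_intros)
qed

lemma has_derivative_geom_mean:
  assumes \<alpha>: "\<And>i. 0 < \<alpha> $ i" and y: "\<And>i. 0 < y $ Inl i"
  shows "(geom_mean \<alpha> has_derivative
           (\<lambda>h. geom_mean \<alpha> y * (\<Sum>i\<in>UNIV. \<alpha> $ i * h $ Inl i / y $ Inl i))) (at y)"
proof -
  have nz: "\<alpha> $ i \<noteq> 0" "y $ Inl i \<noteq> 0" for i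
    using \<alpha>[of i] y[of i] by auto
  have "((\<lambda>y. exp (\<Sum>i\<in>UNIV. \<alpha> $ i * ln (y $ Inl i / \<alpha> $ i))) has_derivative
           (\<lambda>h. geom_mean \<alpha> y * (\<Sum>i\<in>UNIV. \<alpha> $ i * h $ Inl i / y $ Inl i))) (at y)"
    using \<alpha> y nz
    by (auto intro!: derivative_eq_intros sum.cong has_derivative_vec_nth
      simp: geom_mean_eq_exp fun_eq_iff field_simps)
  then show ?thesis
    by (rule has_derivative_transform_within_open[OF _ open_positive_block])
      (use y geom_mean_eq_exp[OF \<alpha>] in auto)
qed


section \<open>The interior of the dual cone\<close>

text \<open>
  The points at which every logarithm in the barrier has a positive argument. For positive weights
  this is an explicit description of the interior of the dual cone, on which the gradient formula
  holds with no closure or boundary cases.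
\<close>

definition barrier_domain :: "real ^ 'd \<Rightarrow> (real ^ ('d + unit)) set" where
  "barrier_domain \<alpha> =
     {y. (\<forall>i. 0 < y $ Inl i) \<and> y $ Inr () < 0 \<and> 0 < geom_mean \<alpha> y + y $ Inr ()}"

lemma open_barrier_domain:
  fixes \<alpha> :: "real ^ 'd"
  assumes \<alpha>: "\<And>i. 0 < \<alpha> $ i"
  shows "open (barrier_domain \<alpha>)"
proof -
  let ?S = "{y :: real ^ ('d + unit). \<forall>i. 0 < y $ Inl i}"
  have "continuous_on ?S (geom_mean \<alpha>)"
    using has_derivative_geom_mean[OF \<alpha>]
    by (auto intro!: continuous_at_imp_continuous_on has_derivative_continuous)
  then have cont: "continuous_on ?S (\<lambda>y. geom_mean \<alpha> y + y $ Inr ())"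
    by (intro continuous_intros)
  have "open (?S \<inter> (\<lambda>y. geom_mean \<alpha> y + y $ Inr ()) -` {0<..})"
    using cont open_positive_block by (rule continuous_open_preimage) simp
  moreover have "open {y :: real ^ ('d + unit). y $ Inr () < 0}"
    by (intro open_Collect_less continuous_intros)
  moreover have "barrier_domain \<alpha> =
      ?S \<inter> (\<lambda>y. geom_mean \<alpha> y + y $ Inr ()) -` {0<..} \<inter> {y. y $ Inr () < 0}"
    by (auto simp: barrier_domain_def)
  ultimately show ?thesis
    by auto
qed

lemma mem_powm_dual_cone:
  "y \<in> powm_dual_cone \<alpha> \<longleftrightarrow>
     (\<forall>i. 0 \<le> y $ Inl i) \<and> y $ Inr () \<le> 0 \<and> - y $ Inr () \<le> geom_mean \<alpha> y"
  by (cases y rule: block_vec_exhaust)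
     (auto simp: powm_dual_cone_def geom_mean_def block_vec_eq_iff)

text \<open>
  An interior point stays in the cone when moved a little in any coordinate direction. Decreasing
  \<open>u\<^sub>i\<close>, increasing \<open>w\<close> and decreasing \<open>w\<close> turns the three weak inequalities into strict ones; the
  last works since the geometric mean does not depend on \<open>w\<close>.
\<close>

lemma interior_powm_dual_cone_subset:
  "interior (powm_dual_cone \<alpha>) \<subseteq> barrier_domain \<alpha>"
proof
  fix z assume "z \<in> interior (powm_dual_cone \<alpha>)"
  then obtain e where e: "0 < e" "ball z e \<subseteq> powm_dual_cone \<alpha>"
    unfolding mem_interior by blast
  have "z + c *\<^sub>R axis k 1 \<in> powm_dual_cone \<alpha>" if "\<bar>c\<bar> = e / 2" for c k
    using that e by (intro subsetD[OF e(2)]) (simp add: dist_norm)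
  note near = this[unfolded mem_powm_dual_cone]
  have "0 < z $ Inl i" for i
    using near[of "- (e/2)" "Inl i"] e(1) by (auto simp: axis_def dest!: spec[of _ i])
  moreover have "z $ Inr () < 0"
    using near[of "e/2" "Inr ()"] e(1) by (auto simp: axis_def)
  moreover have "0 < geom_mean \<alpha> z + z $ Inr ()"
  proof -
    have "geom_mean \<alpha> (z + (- (e/2)) *\<^sub>R axis (Inr ()) 1) = geom_mean \<alpha> z"
      by (simp add: geom_mean_def axis_def)
    then show ?thesis
      using near[of "- (e/2)" "Inr ()"] e(1) by (auto simp: axis_def)
  qed
  ultimately show "z \<in> barrier_domain \<alpha>"
    by (simp add: barrier_domain_def)
qed


section \<open>Gradient and Hessian of the barrier\<close>

definition barrier_gradient :: "real ^ 'd \<Rightarrow> real ^ ('d + unit) \<Rightarrow> real ^ ('d + unit)" where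
  "barrier_gradient \<alpha> y =
     block_vec
       (\<chi> i. - (\<alpha> $ i * geom_mean \<alpha> y / (y $ Inl i * (geom_mean \<alpha> y + y $ Inr ())))
             - (1 - \<alpha> $ i) / y $ Inl i)
       (- 1 / (geom_mean \<alpha> y + y $ Inr ()) - 1 / y $ Inr ())"

lemma GDERIV_powm_dual_barrier:
  assumes \<alpha>: "\<And>i. 0 < \<alpha> $ i" and y: "y \<in> barrier_domain \<alpha>"
  shows "GDERIV (powm_dual_barrier \<alpha>) y :> barrier_gradient \<alpha> y"
proof -
  define \<phi> where "\<phi> = geom_mean \<alpha> y"
  define \<zeta> where "\<zeta> = \<phi> + y $ Inr ()"
  have pos: "0 < y $ Inl i" for i
    using y by (simp add: barrier_domain_def)
  have w: "y $ Inr () < 0" and \<zeta>: "0 < \<zeta>"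
    using y by (simp_all add: barrier_domain_def \<zeta>_def \<phi>_def)
  have nz: "\<alpha> $ i \<noteq> 0" "y $ Inl i \<noteq> 0" for i
    using \<alpha>[of i] pos[of i] by auto
  note [derivative_intros] = has_derivative_geom_mean[OF \<alpha> pos]
  have log_mean: "((\<lambda>y. ln (geom_mean \<alpha> y + y $ Inr ())) has_derivative
      (\<lambda>h. (\<phi> * (\<Sum>i\<in>UNIV. \<alpha> $ i * h $ Inl i / y $ Inl i) + h $ Inr ()) / \<zeta>)) (at y)"
    using \<zeta> by (auto intro!: derivative_eq_intros has_derivative_vec_nth
      simp: \<zeta>_def \<phi>_def field_simps)
  have log_sum: "((\<lambda>y. \<Sum>i\<in>UNIV. (1 - \<alpha> $ i) * ln (y $ Inl i / \<alpha> $ i)) has_derivative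
      (\<lambda>h. \<Sum>i\<in>UNIV. (1 - \<alpha> $ i) * h $ Inl i / y $ Inl i)) (at y)"
    using \<alpha> pos nz
    by (auto intro!: derivative_eq_intros sum.cong has_derivative_vec_nth
      simp: fun_eq_iff field_simps)
  have log_last: "((\<lambda>y. ln (- y $ Inr ())) has_derivative (\<lambda>h. h $ Inr () / y $ Inr ())) (at y)"
    using w by (auto intro!: derivative_eq_intros has_derivative_vec_nth
      simp: fun_eq_iff field_simps)
  have grad: "h \<bullet> barrier_gradient \<alpha> y =
      - ((\<phi> * (\<Sum>i\<in>UNIV. \<alpha> $ i * h $ Inl i / y $ Inl i) + h $ Inr ()) / \<zeta>)
      - (\<Sum>i\<in>UNIV. (1 - \<alpha> $ i) * h $ Inl i / y $ Inl i) - h $ Inr () / y $ Inr ()" for h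
  proof -
    have "(\<Sum>i\<in>UNIV. h $ Inl i * (- (\<alpha> $ i * \<phi> / (y $ Inl i * \<zeta>)) - (1 - \<alpha> $ i) / y $ Inl i)) =
        - (\<phi> / \<zeta> * (\<Sum>i\<in>UNIV. \<alpha> $ i * h $ Inl i / y $ Inl i))
        - (\<Sum>i\<in>UNIV. (1 - \<alpha> $ i) * h $ Inl i / y $ Inl i)"
      unfolding sum_distrib_left sum_negf [symmetric] sum_subtractf [symmetric]
      using nz \<zeta> by (intro sum.cong) (auto simp: field_simps)
    then show ?thesis
      unfolding barrier_gradient_def inner_block_vec
      by (simp add: \<phi>_def [symmetric] \<zeta>_def [symmetric] add_divide_distrib algebra_simps)
  qed
  show ?thesis
    unfolding gderiv_def grad powm_dual_barrier_def Let_def geom_mean_def [symmetric]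
    by (intro has_derivative_diff has_derivative_minus log_mean log_sum log_last)
qed

text \<open>
  The derivative is stated as a linear map, and in terms of \<open>\<tau>\<close>, to match the action of the structured
  matrix: the coefficient \<open>\<phi>\<^sup>2 - \<zeta> \<phi> = p0\<^sup>2 - q0\<^sup>2\<close> of \<open>\<tau> \<tau>\<^sup>T\<close> collects the parts of
  \<open>p p\<^sup>T - q q\<^sup>T\<close> in the leading block.
\<close>

lemma has_derivative_barrier_gradient:
  fixes \<alpha> u \<tau> :: "real ^ 'd"
  assumes \<alpha>: "\<And>i. 0 < \<alpha> $ i" and z: "block_vec u w \<in> barrier_domain \<alpha>"
    and \<phi>: "\<phi> = geom_mean \<alpha> (block_vec u w)" and \<zeta>: "\<zeta> = \<phi> + w"
    and \<tau>: "\<tau> = (\<chi> i. \<alpha> $ i / (u $ i * \<zeta>))"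
  shows "(barrier_gradient \<alpha> has_derivative
     (\<lambda>h. block_vec
        (\<chi> i. (\<tau> $ i * \<phi> / u $ i + (1 - \<alpha> $ i) / (u $ i)\<^sup>2) * h $ Inl i
              + (\<phi>\<^sup>2 - \<zeta> * \<phi>) * \<tau> $ i * (\<Sum>j\<in>UNIV. \<tau> $ j * h $ Inl j) + \<phi> * \<tau> $ i * h $ Inr () / \<zeta>)
        (\<phi> / \<zeta> * (\<Sum>j\<in>UNIV. \<tau> $ j * h $ Inl j) + (1 / \<zeta>\<^sup>2 + 1 / w\<^sup>2) * h $ Inr ())))
     (at (block_vec u w))"
proof -
  have u: "0 < u $ i" for i
    using z by (simp add: barrier_domain_def)
  have w: "w < 0" and \<zeta>_pos: "0 < \<zeta>"
    using z by (simp_all add: barrier_domain_def \<zeta> \<phi>)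
  have nz: "u $ i \<noteq> 0" "\<zeta> \<noteq> 0" "w \<noteq> 0" for i
    using u[of i] w \<zeta>_pos by auto
  define T where "T h = (\<Sum>j\<in>UNIV. \<tau> $ j * h $ Inl j)" for h :: "real ^ ('d + unit)"
  have dsum: "(\<Sum>j\<in>UNIV. \<alpha> $ j * h $ Inl j / u $ j) = \<zeta> * T h" for h
    unfolding T_def sum_distrib_left using nz by (intro sum.cong) (auto simp: \<tau>)
  have dmean: "(geom_mean \<alpha> has_derivative (\<lambda>h. \<phi> * \<zeta> * T h)) (at (block_vec u w))"
    using has_derivative_geom_mean[of \<alpha> "block_vec u w"] \<alpha> u by (simp add: dsum \<phi> mult.assoc)
  note [derivative_intros] = dmean has_derivative_vec_nth
  show ?thesis
    unfolding barrier_gradient_def T_def [symmetric]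
  proof (rule has_derivative_block_vec, goal_cases)
    case (1 i)
    have \<tau>_i: "\<tau> $ i = \<alpha> $ i / (u $ i * \<zeta>)"
      by (simp add: \<tau>)
    have "((\<lambda>y. - (\<alpha> $ i * geom_mean \<alpha> y / (y $ Inl i * (geom_mean \<alpha> y + y $ Inr ())))
             - (1 - \<alpha> $ i) / y $ Inl i) has_derivative
      (\<lambda>h. (\<tau> $ i * \<phi> / u $ i + (1 - \<alpha> $ i) / (u $ i)\<^sup>2) * h $ Inl i
              + (\<phi>\<^sup>2 - \<zeta> * \<phi>) * \<tau> $ i * T h + \<phi> * \<tau> $ i * h $ Inr () / \<zeta>)) (at (block_vec u w))"
      using nz
      by (auto intro!: derivative_eq_intros ext simp: \<phi> [symmetric] \<zeta> [symmetric] \<tau>_i)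
         (simp add: field_simps power2_eq_square)
    then show ?case
      by simp
  next
    case 2
    have "((\<lambda>y. - 1 / (geom_mean \<alpha> y + y $ Inr ()) - 1 / y $ Inr ()) has_derivative
      (\<lambda>h. \<phi> / \<zeta> * T h + (1 / \<zeta>\<^sup>2 + 1 / w\<^sup>2) * h $ Inr ())) (at (block_vec u w))"
      using nz
      by (auto intro!: derivative_eq_intros ext simp: \<phi> [symmetric] \<zeta> [symmetric])
         (simp add: field_simps power2_eq_square)
    then show ?case
      by simp
  qed
qed


section \<open>Definiteness\<close>

text \<open>The difference of the two sides is the variance of \<open>y\<close> under the weights \<open>a\<close>.\<close>

lemma weighted_square_mean:
  fixes a y :: "'i \<Rightarrow> real"
  assumes "\<And>i. i \<in> S \<Longrightarrow> 0 \<le> a i" "sum a S = 1"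
  shows "(\<Sum>i\<in>S. a i * y i)\<^sup>2 \<le> (\<Sum>i\<in>S. a i * (y i)\<^sup>2)"
proof -
  define m where "m = (\<Sum>i\<in>S. a i * y i)"
  have "0 \<le> (\<Sum>i\<in>S. a i * (y i - m)\<^sup>2)"
    using assms(1) by (intro sum_nonneg) auto
  also have "\<dots> = (\<Sum>i\<in>S. a i * (y i)\<^sup>2 - 2 * m * (a i * y i) + m\<^sup>2 * a i)"
    by (intro sum.cong) (auto simp: power2_eq_square algebra_simps)
  also have "\<dots> = (\<Sum>i\<in>S. a i * (y i)\<^sup>2) - 2 * m * (\<Sum>i\<in>S. a i * y i) + m\<^sup>2 * sum a S"
    by (simp only: sum.distrib sum_subtractf sum_distrib_left [symmetric])
  also have "\<dots> = (\<Sum>i\<in>S. a i * (y i)\<^sup>2) - m\<^sup>2"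
    by (simp add: assms(2) m_def [symmetric] power2_eq_square)
  finally show ?thesis
    by (simp add: m_def)
qed

lemma weight_less_one:
  fixes \<alpha> :: "real ^ 'd"
  assumes "\<And>i. 0 < \<alpha> $ i" "(\<Sum>i\<in>UNIV. \<alpha> $ i) = 1" "2 \<le> CARD('d)"
  shows "\<alpha> $ i < 1"
proof -
  have "UNIV - {i} \<noteq> {}"
  proof
    assume "UNIV - {i} = {}"
    then have "CARD('d) \<le> card {i}"
      by (intro card_mono) auto
    then show False
      using assms(3) by simp
  qed
  then have "0 < (\<Sum>j\<in>UNIV - {i}. \<alpha> $ j)"
    using assms(1) by (intro sum_pos) auto
  then show ?thesis
    using assms(2) by (simp add: sum.remove[of UNIV i])
qed

text \<open>
  The scaling \<open>y\<^sub>i = h\<^sub>i / u\<^sub>i\<close> turns the diagonal part into \<open>\<phi> / \<zeta> \<cdot> \<Sum>\<^sub>i \<alpha>\<^sub>i y\<^sub>i\<^sup>2\<close> plus the terms with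
  weights \<open>1 - \<alpha>\<^sub>i\<close>, and the subtracted rank-one part into \<open>\<phi> / \<zeta> \<cdot> (\<Sum>\<^sub>i \<alpha>\<^sub>i y\<^sub>i)\<^sup>2\<close>. The weighted mean
  inequality absorbs the latter completely; strictness comes only from the terms with weights
  \<open>1 - \<alpha>\<^sub>i\<close> and from the last coordinate.
\<close>

lemma quadratic_form_pos:
  fixes \<alpha> u \<tau> :: "real ^ 'd" and h :: "real ^ ('d + unit)"
  assumes \<alpha>: "\<And>i. 0 < \<alpha> $ i" "(\<Sum>i\<in>UNIV. \<alpha> $ i) = 1" "2 \<le> CARD('d)"
    and u: "\<And>i. 0 < u $ i" and w: "w \<noteq> 0" and \<phi>: "0 < \<phi>" and \<zeta>: "0 < \<zeta>"
    and \<tau>: "\<tau> = (\<chi> i. \<alpha> $ i / (u $ i * \<zeta>))" and h: "h \<noteq> 0"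
  shows "0 < (\<Sum>i\<in>UNIV. (\<tau> $ i * \<phi> / u $ i + (1 - \<alpha> $ i) / (u $ i)\<^sup>2) * (h $ Inl i)\<^sup>2)
           - \<zeta> * \<phi> * (\<Sum>i\<in>UNIV. \<tau> $ i * h $ Inl i)\<^sup>2 + (h $ Inr ())\<^sup>2 / w\<^sup>2"
proof -
  define y where "y i = h $ Inl i / u $ i" for i
  have nz: "u $ i \<noteq> 0" "\<zeta> \<noteq> 0" for i
    using u[of i] \<zeta> by auto
  have lt: "\<alpha> $ i < 1" for i
    using weight_less_one[OF \<alpha>] .
  have diag: "(\<Sum>i\<in>UNIV. (\<tau> $ i * \<phi> / u $ i + (1 - \<alpha> $ i) / (u $ i)\<^sup>2) * (h $ Inl i)\<^sup>2) =
      \<phi> / \<zeta> * (\<Sum>i\<in>UNIV. \<alpha> $ i * (y i)\<^sup>2) + (\<Sum>i\<in>UNIV. (1 - \<alpha> $ i) * (y i)\<^sup>2)"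
    unfolding sum_distrib_left sum.distrib [symmetric] using nz
    by (intro sum.cong) (auto simp: \<tau> y_def field_simps power2_eq_square)
  have sum_\<tau>: "(\<Sum>i\<in>UNIV. \<tau> $ i * h $ Inl i) = (\<Sum>i\<in>UNIV. \<alpha> $ i * y i) / \<zeta>"
    unfolding sum_divide_distrib using nz by (intro sum.cong) (auto simp: \<tau> y_def)
  have mean: "\<zeta> * \<phi> * (\<Sum>i\<in>UNIV. \<tau> $ i * h $ Inl i)\<^sup>2 = \<phi> / \<zeta> * (\<Sum>i\<in>UNIV. \<alpha> $ i * y i)\<^sup>2"
    unfolding sum_\<tau> using \<zeta> by (simp add: power2_eq_square)
  have "\<phi> / \<zeta> * (\<Sum>i\<in>UNIV. \<alpha> $ i * y i)\<^sup>2 \<le> \<phi> / \<zeta> * (\<Sum>i\<in>UNIV. \<alpha> $ i * (y i)\<^sup>2)"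
    using \<phi> \<zeta> \<alpha>(1,2) by (intro mult_left_mono weighted_square_mean) (auto simp: less_imp_le)
  moreover have "0 < (\<Sum>i\<in>UNIV. (1 - \<alpha> $ i) * (y i)\<^sup>2) + (h $ Inr ())\<^sup>2 / w\<^sup>2"
  proof -
    have nonneg: "0 \<le> (\<Sum>i\<in>UNIV. (1 - \<alpha> $ i) * (y i)\<^sup>2)" "0 \<le> (h $ Inr ())\<^sup>2 / w\<^sup>2"
      using lt by (auto intro!: sum_nonneg simp: less_imp_le)
    obtain k where k: "h $ k \<noteq> 0"
      using h by (auto simp: vec_eq_iff)
    show ?thesis
    proof (cases k)
      case (Inl i)
      then have "0 < (1 - \<alpha> $ i) * (y i)\<^sup>2"
        using k lt[of i] nz by (simp add: y_def)
      then have "0 < (\<Sum>i\<in>UNIV. (1 - \<alpha> $ i) * (y i)\<^sup>2)"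
        using lt by (intro sum_pos2[of UNIV i]) (auto simp: less_imp_le)
      then show ?thesis
        using nonneg by linarith
    next
      case (Inr x)
      then have "0 < (h $ Inr ())\<^sup>2 / w\<^sup>2"
        using k w by simp
      then show ?thesis
        using nonneg by linarith
    qed
  qed
  ultimately show ?thesis
    unfolding diag mean by linarith
qed


section \<open>The augmented-sparse decomposition\<close>

theorem theorem3:
  fixes \<alpha> u \<tau> :: "real ^ 'd"
    and w \<phi> \<zeta> \<theta> p0 p1 q0 r1 :: real
    and z p q r :: "real ^ ('d + unit)"
    and D :: "real ^ ('d + unit) ^ ('d + unit)"
  assumes \<alpha>_pos: "\<And>i. 0 < \<alpha> $ i"
    and \<alpha>_sum: "(\<Sum>i\<in>UNIV. \<alpha> $ i) = 1"
    and z: "z = block_vec u w"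
    and z_int: "z \<in> interior (powm_dual_cone \<alpha>)"
    and \<phi>: "\<phi> = (\<Prod>i\<in>UNIV. (u $ i / \<alpha> $ i) powr (\<alpha> $ i))"
    and \<zeta>: "\<zeta> = \<phi> + w"
    and \<tau>: "\<tau> = (\<chi> i. \<alpha> $ i / (u $ i * \<zeta>))"
    and \<theta>: "\<theta> = 1 + 1 / w\<^sup>2"
    and p0: "p0 = \<phi>"
    and p1: "p1 = 1"
    and q0: "q0 = sqrt (\<zeta> * \<phi>)"
    and r1: "r1 = \<zeta>"
    and D: "D = diag_mat (block_vec (\<chi> i. \<tau> $ i * \<phi> / u $ i + (1 - \<alpha> $ i) / (u $ i)\<^sup>2) \<theta>)"
    and p: "p = block_vec (p0 *\<^sub>R \<tau>) (p1 / \<zeta>)"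
    and q: "q = block_vec (q0 *\<^sub>R \<tau>) 0"
    and r: "r = block_vec 0 (r1 / \<zeta>)"
  shows "\<exists>H. has_hessian (powm_dual_barrier \<alpha>) H z \<and>
             H = D + outer p p - outer q q - outer r r \<and>
             (2 \<le> CARD('d) \<longrightarrow>
                pos_def (D - outer q q - outer r r) \<and> augmented_sparse H D [p] [q, r])"
proof -
  have z_dom: "block_vec u w \<in> barrier_domain \<alpha>"
    using interior_powm_dual_cone_subset z_int z by blast
  have u_pos: "0 < u $ i" for i
    using z_dom by (simp add: barrier_domain_def)
  have \<phi>': "\<phi> = geom_mean \<alpha> (block_vec u w)"
    by (simp add: \<phi> geom_mean_def)
  have \<phi>_pos: "0 < \<phi>"
    unfolding \<phi>' using \<alpha>_pos u_pos by (intro geom_mean_pos) auto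
  have w: "w < 0" and \<zeta>_pos: "0 < \<zeta>"
    using z_dom by (simp_all add: barrier_domain_def \<zeta> \<phi>')
  have q0_sq: "q0 * q0 = \<zeta> * \<phi>"
    using \<phi>_pos \<zeta>_pos by (simp add: q0)
  have r_last: "r = block_vec 0 1"
    using \<zeta>_pos by (simp add: r r1)
  define T where "T h = (\<Sum>j\<in>UNIV. \<tau> $ j * h $ Inl j)" for h :: "real ^ ('d + unit)"
  have p_h: "p \<bullet> h = \<phi> * T h + h $ Inr () / \<zeta>"
    and q_h: "q \<bullet> h = q0 * T h" and r_h: "r \<bullet> h = h $ Inr ()" for h
    unfolding p q r_last inner_commute[of _ h] inner_block_vec T_def
    by (simp_all add: p0 p1 sum_distrib_left mult_ac)
  have D_h: "D *v h = block_vec (\<chi> i. (\<tau> $ i * \<phi> / u $ i + (1 - \<alpha> $ i) / (u $ i)\<^sup>2) * h $ Inl i)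
      (\<theta> * h $ Inr ())" for h
    by (auto simp: D diag_mat_mult_vec vec_eq_iff block_vec_def split: sum.split)
  define H where "H = D + outer p p - outer q q - outer r r"
  have H_h: "H *v h = block_vec
        (\<chi> i. (\<tau> $ i * \<phi> / u $ i + (1 - \<alpha> $ i) / (u $ i)\<^sup>2) * h $ Inl i
              + (\<phi>\<^sup>2 - \<zeta> * \<phi>) * \<tau> $ i * T h + \<phi> * \<tau> $ i * h $ Inr () / \<zeta>)
        (\<phi> / \<zeta> * T h + (1 / \<zeta>\<^sup>2 + 1 / w\<^sup>2) * h $ Inr ())" for h
  proof -
    have "H *v h = D *v h + (p \<bullet> h) *\<^sub>R p - (q \<bullet> h) *\<^sub>R q - (r \<bullet> h) *\<^sub>R r"
      unfolding H_def
      by (simp add: matrix_vector_mult_add_rdistrib matrix_vector_mult_diff_rdistrib outer_mult_vec)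
    also have "\<dots> = block_vec
        (\<chi> i. (\<tau> $ i * \<phi> / u $ i + (1 - \<alpha> $ i) / (u $ i)\<^sup>2) * h $ Inl i
              + (\<phi>\<^sup>2 - \<zeta> * \<phi>) * \<tau> $ i * T h + \<phi> * \<tau> $ i * h $ Inr () / \<zeta>)
        (\<phi> / \<zeta> * T h + (1 / \<zeta>\<^sup>2 + 1 / w\<^sup>2) * h $ Inr ())" (is "_ = ?R")
      unfolding vec_eq_iff
    proof
      fix k show "(D *v h + (p \<bullet> h) *\<^sub>R p - (q \<bullet> h) *\<^sub>R q - (r \<bullet> h) *\<^sub>R r) $ k = ?R $ k"
      proof (cases k)
        case (Inl i)
        show ?thesis
          unfolding Inl p_h q_h r_h D_h using q0_sq
          by (simp add: p q r_last p0 p1 algebra_simps power2_eq_square)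
      next
        case (Inr j)
        show ?thesis
          unfolding Inr p_h q_h r_h D_h
          by (simp add: p q r_last p0 p1 \<theta> algebra_simps power2_eq_square)
      qed
    qed
    finally show ?thesis .
  qed
  have hess: "has_hessian (powm_dual_barrier \<alpha>) H z"
    unfolding has_hessian_def
  proof (intro exI conjI)
    show "(barrier_gradient \<alpha> has_derivative (\<lambda>h. H *v h)) (at z)"
      unfolding H_h T_def z
      by (rule has_derivative_barrier_gradient[OF \<alpha>_pos z_dom \<phi>' \<zeta> \<tau>])
    show "\<forall>\<^sub>F y in nhds z. GDERIV (powm_dual_barrier \<alpha>) y :> barrier_gradient \<alpha> y"
      using GDERIV_powm_dual_barrier[OF \<alpha>_pos] open_barrier_domain[OF \<alpha>_pos] z_dom
      unfolding eventually_nhds z by blast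
  qed
  have pd: "pos_def (D - outer q q - outer r r)" if card: "2 \<le> CARD('d)"
    unfolding pos_def_def
  proof (intro conjI allI impI)
    show "transpose (D - outer q q - outer r r) = D - outer q q - outer r r"
      by (simp add: D transpose_diff_real)
    fix h :: "real ^ ('d + unit)" assume "h \<noteq> 0"
    have "h \<bullet> ((D - outer q q - outer r r) *v h) = h \<bullet> (D *v h) - (q \<bullet> h)\<^sup>2 - (r \<bullet> h)\<^sup>2"
      by (simp add: matrix_vector_mult_diff_rdistrib outer_mult_vec inner_diff_right
          power2_eq_square inner_commute)
    also have "\<dots> = (\<Sum>i\<in>UNIV. (\<tau> $ i * \<phi> / u $ i + (1 - \<alpha> $ i) / (u $ i)\<^sup>2) * (h $ Inl i)\<^sup>2)
           - \<zeta> * \<phi> * (T h)\<^sup>2 + (h $ Inr ())\<^sup>2 / w\<^sup>2"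
      unfolding D_h q_h r_h inner_block_vec using q0_sq
      by (simp add: \<theta> power2_eq_square algebra_simps)
    also have "0 < \<dots>"
      unfolding T_def using \<alpha>_pos \<alpha>_sum card u_pos w \<phi>_pos \<zeta>_pos \<tau> \<open>h \<noteq> 0\<close>
      by (intro quadratic_form_pos) auto
    finally show "0 < h \<bullet> ((D - outer q q - outer r r) *v h)" .
  qed
  show ?thesis
  proof (intro exI[of _ H] conjI impI)
    show "has_hessian (powm_dual_barrier \<alpha>) H z"
      by (rule hess)
    show "H = D + outer p p - outer q q - outer r r"
      by (rule H_def)
    assume card: "2 \<le> CARD('d)"
    show "pos_def (D - outer q q - outer r r)"
      by (rule pd[OF card])
    then show "augmented_sparse H D [p] [q, r]"
      by (simp add: augmented_sparse_def H_def D diff_diff_eq)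
  qed
qed

end
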